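(* Let $\mathbb{F}$ be a normed field, let $\mathfrak{A}$ be a metric $\mathbb{F}$-algebra, and let $C(\mathfrak{A})$ be its completion. Then $\mathfrak{A}$ and $C(\mathfrak{A})$ satisfy the same polynomial identities, i.e. $\mathsf{T}(C(\mathfrak{A}))=\mathsf{T}(\mathfrak{A})$.
   Context: Algebras are associative and not necessarily unital. A normed field is a field $\mathbb{F}$ equipped with a map $|\cdot|:\mathbb{F}\to\mathbb{R}_{\geq 0}$ having the usual properties of a norm ($|\lambda|=0$ iff $\lambda=0$, and $|\lambda+\mu|\leq|\lambda|+|\mu|$) and satisfying $|-\lambda|=|\lambda|$ and $|\lambda\mu|\leq|\lambda|\cdot|\mu|$ for all $\lambda,\mu\in\mathbb{F}$. When $\mathrm{char}(\mathbb{F})=0$, it is moreover assumed, as part of the definition, that $|n\cdot\lambda|=n\cdot|\lambda|$ for all $n\in\mathbb{N}$ and $\lambda\in\mathbb{F}$. Let $\mathbb{F}$ be a normed field. A metric $\mathbb{F}$-algebra is an associative $\mathbb{F}$-algebra $\mathfrak{A}$ which is also a metric space $(\mathfrak{A},\mathsf{d})$, such that there is a real number $\gamma>0$ with: (i) $\mathsf{d}(a+c,b+c)\leq\gamma\,\mathsf{d}(a,b)$ for all $a,b,c\in\mathfrak{A}$; (ii) $\mathsf{d}(\lambda a,\lambda b)\leq\gamma|\lambda|\,\mathsf{d}(a,b)$ for all $\lambda\in\mathbb{F}$, $a,b\in\mathfrak{A}$; (iii) $\mathsf{d}(ac,bc)\leq\gamma\,\mathsf{d}(c,0)\,\mathsf{d}(a,b)$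 and $\mathsf{d}(ca,cb)\leq\gamma\,\mathsf{d}(c,0)\,\mathsf{d}(a,b)$ for all $a,b,c\in\mathfrak{A}$. The completion $C(\mathfrak{A})$ is the metric completion of $(\mathfrak{A},\mathsf{d})$, i.e. a complete metric space containing $\mathfrak{A}$ isometrically as a dense subset, with addition, multiplication and multiplication by scalars of $\mathbb{F}$ extended from $\mathfrak{A}$ by continuity; with these operations $C(\mathfrak{A})$ is a complete metric $\mathbb{F}$-algebra (a metric $\mathbb{F}$-algebra whose metric is complete) containing $\mathfrak{A}$ as a subalgebra. Let $\mathbb{F}\langle X\rangle$ be the free associative $\mathbb{F}$-algebra freely generated by a countable set $X=\{x_1,x_2,\dots\}$ of noncommuting indeterminates (as algebras need not be unital, its elements are noncommutative polynomials without constant term). An element $g=g(x_1,\dots,x_d)\in\mathbb{F}\langle X\rangle$ is a polynomial identity of an $\mathbb{F}$-algebra $\mathfrak{B}$ if $g(b_1,\dots,b_d)=0$ for all $b_1,\dots,b_d\in\mathfrak{B}$. The set of all polynomial identities of $\mathfrak{B}$ is denoted $\mathsf{T}(\mathfrak{B})$. *)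

theory Defs
  imports "HOL-Analysis.Analysis" "HOL-Library.Poly_Mapping"
begin

locale normed_field =
  fixes nrm :: "'f::field \<Rightarrow> real"
  assumes nrm_nonneg: "0 \<le> nrm x"
    and nrm_eq_0_iff: "nrm x = 0 \<longleftrightarrow> x = 0"
    and nrm_add_le: "nrm (x + y) \<le> nrm x + nrm y"
    and nrm_minus: "nrm (- x) = nrm x"
    and nrm_mult_le: "nrm (x * y) \<le> nrm x * nrm y"
    and nrm_of_nat_mult: "CHAR('f) = 0 \<Longrightarrow> nrm (of_nat n * x) = real n * nrm x"

text \<open>The class \<^class>\<open>ring\<close> is that of associative rings, possibly without unit.\<close>

locale assoc_algebra = vector_space smul
  for smul :: "'f::field \<Rightarrow> 'a::ring \<Rightarrow> 'a" +
  assumes scale_mult_left: "smul k x * y = smul k (x * y)"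
    and scale_mult_right: "x * smul k y = smul k (x * y)"

locale metric_algebra = normed_field nrm + assoc_algebra smul
  for nrm :: "'f::field \<Rightarrow> real"
    and smul :: "'f \<Rightarrow> 'a::{ring, metric_space} \<Rightarrow> 'a" +
  assumes metric_bounds: "\<exists>\<gamma>>0.
      (\<forall>a b c :: 'a. dist (a + c) (b + c) \<le> \<gamma> * dist a b) \<and>
      (\<forall>k a b. dist (smul k a) (smul k b) \<le> \<gamma> * nrm k * dist a b) \<and>
      (\<forall>a b c :: 'a. dist (a * c) (b * c) \<le> \<gamma> * dist c 0 * dist a b) \<and>
      (\<forall>a b c :: 'a. dist (c * a) (c * b) \<le> \<gamma> * dist c 0 * dist a b)"

text \<open>
  A completion of a metric algebra is specified by its defining properties: the space is
  complete (class \<^class>\<open>complete_space\<close>), \<open>emb\<close> is an isometric embedding with dense image,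
  and the operations are the continuous extensions of the given ones. That \<open>smulC\<close> turns
  the completion into a metric algebra is not assumed; it is the lemma
  \<open>metric_algebra_completion\<close> below.
\<close>

locale algebra_completion = metric_algebra nrm smul
  for nrm :: "'f::field \<Rightarrow> real"
    and smul :: "'f \<Rightarrow> 'a::{ring, metric_space} \<Rightarrow> 'a"
    and smulC :: "'f \<Rightarrow> 'c::{ring, complete_space} \<Rightarrow> 'c"
    and emb :: "'a \<Rightarrow> 'c" +
  assumes dist_emb: "dist (emb a) (emb b) = dist a b"
    and dense_emb: "closure (range emb) = UNIV"
    and emb_add: "emb (a + b) = emb a + emb b"
    and emb_mult: "emb (a * b) = emb a * emb b"
    and emb_scale: "emb (smul k a) = smulC k (emb a)"
    and continuous_add: "continuous_on UNIV (\<lambda>p::'c \<times> 'c. fst p + snd p)"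
    and continuous_mult: "continuous_on UNIV (\<lambda>p::'c \<times> 'c. fst p * snd p)"
    and continuous_scale: "continuous_on UNIV (smulC k)"

text \<open>
  Words in the indeterminates form a monoid under concatenation, so \<open>nat list \<Rightarrow>\<^sub>0 'f\<close> with
  the multiplication of \<^theory>\<open>HOL-Library.Poly_Mapping\<close> is the free unital algebra on
  countably many indeterminates. The free algebra without unit is its ideal of elements with
  zero constant term.
\<close>

instantiation list :: (type) monoid_add
begin

definition zero_list :: "'a list" where "zero_list = []"

definition plus_list :: "'a list \<Rightarrow> 'a list \<Rightarrow> 'a list" where "plus_list = append"

instance by standard (simp_all add: zero_list_def plus_list_def)

end

definition free_algebra :: "(nat list \<Rightarrow>\<^sub>0 'f::field) set" where
  "free_algebra = {g. Poly_Mapping.lookup g [] = 0}"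

text \<open>The value at the empty word is a dummy; it is never used on \<^const>\<open>free_algebra\<close>.\<close>

fun word_eval :: "(nat \<Rightarrow> 'a::ring) \<Rightarrow> nat list \<Rightarrow> 'a" where
  "word_eval b [] = 0"
| "word_eval b [i] = b i"
| "word_eval b (i # j # w) = b i * word_eval b (j # w)"

definition poly_eval ::
    "('f::field \<Rightarrow> 'a::ring \<Rightarrow> 'a) \<Rightarrow> (nat \<Rightarrow> 'a) \<Rightarrow> (nat list \<Rightarrow>\<^sub>0 'f) \<Rightarrow> 'a" where
  "poly_eval smul b g =
     (\<Sum>w\<in>Poly_Mapping.keys g. smul (Poly_Mapping.lookup g w) (word_eval b w))"

definition polynomial_identities ::
    "('f::field \<Rightarrow> 'a::ring \<Rightarrow> 'a) \<Rightarrow> (nat list \<Rightarrow>\<^sub>0 'f) set" where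
  "polynomial_identities smul = {g \<in> free_algebra. \<forall>b. poly_eval smul b g = 0}"

text \<open>
  Evaluation is the algebra homomorphism on the free algebra that extends the given
  assignment of the indeterminates.
\<close>

context assoc_algebra
begin

lemma poly_eval_superset:
  assumes "finite S" "Poly_Mapping.keys g \<subseteq> S"
  shows "poly_eval smul b g = (\<Sum>w\<in>S. smul (Poly_Mapping.lookup g w) (word_eval b w))"
  unfolding poly_eval_def
  by (rule sum.mono_neutral_left) (use assms in \<open>auto simp: in_keys_iff\<close>)

lemma poly_eval_single: "poly_eval smul b (Poly_Mapping.single w k) = smul k (word_eval b w)"
  by (subst poly_eval_superset[of "{w}"]) auto

lemma poly_eval_indeterminate: "poly_eval smul b (Poly_Mapping.single [i] 1) = b i"
  by (simp add: poly_eval_single)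

lemma poly_eval_zero: "poly_eval smul b 0 = 0"
  by (simp add: poly_eval_def)

lemma poly_eval_add: "poly_eval smul b (g + h) = poly_eval smul b g + poly_eval smul b h"
proof -
  let ?S = "Poly_Mapping.keys g \<union> Poly_Mapping.keys h"
  have "Poly_Mapping.keys (g + h) \<subseteq> ?S"
    by (rule Poly_Mapping.keys_add)
  then show ?thesis
    by (simp add: poly_eval_superset[of ?S] lookup_add scale_left_distrib sum.distrib)
qed

lemma poly_eval_sum: "poly_eval smul b (\<Sum>i\<in>I. g i) = (\<Sum>i\<in>I. poly_eval smul b (g i))"
  by (induction I rule: infinite_finite_induct) (simp_all add: poly_eval_zero poly_eval_add)

lemma word_eval_append:
  "v \<noteq> [] \<Longrightarrow> w \<noteq> [] \<Longrightarrow> word_eval b (v @ w) = word_eval b v * word_eval b w"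
proof (induction b v rule: word_eval.induct)
  case (2 b i)
  then show ?case by (cases w) auto
qed (auto simp: mult.assoc)

lemma poly_eval_mult:
  assumes "g \<in> free_algebra" "h \<in> free_algebra"
  shows "poly_eval smul b (g * h) = poly_eval smul b g * poly_eval smul b h"
proof -
  let ?G = "Poly_Mapping.keys g" and ?H = "Poly_Mapping.keys h"
  have expand: "p = (\<Sum>w\<in>Poly_Mapping.keys p. Poly_Mapping.single w (Poly_Mapping.lookup p w))"
    for p :: "nat list \<Rightarrow>\<^sub>0 'f"
    by (rule poly_mapping_eqI)
      (auto simp: lookup_sum lookup_single when_def in_keys_iff)
  have "g * h = (\<Sum>v\<in>?G. \<Sum>w\<in>?H.
      Poly_Mapping.single (v @ w) (Poly_Mapping.lookup g v * Poly_Mapping.lookup h w))"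
    by (subst expand[of g], subst expand[of h])
      (simp add: sum_product mult_single plus_list_def)
  then have "poly_eval smul b (g * h) = (\<Sum>v\<in>?G. \<Sum>w\<in>?H.
      smul (Poly_Mapping.lookup g v * Poly_Mapping.lookup h w) (word_eval b (v @ w)))"
    by (simp add: poly_eval_sum poly_eval_single)
  also have "\<dots> = (\<Sum>v\<in>?G. \<Sum>w\<in>?H.
      smul (Poly_Mapping.lookup g v) (word_eval b v) *
      smul (Poly_Mapping.lookup h w) (word_eval b w))"
  proof (intro sum.cong refl)
    fix v w assume "v \<in> ?G" "w \<in> ?H"
    with assms have "v \<noteq> []" "w \<noteq> []"
      by (auto simp: free_algebra_def in_keys_iff)
    then show "smul (Poly_Mapping.lookup g v * Poly_Mapping.lookup h w) (word_eval b (v @ w)) =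
        smul (Poly_Mapping.lookup g v) (word_eval b v) *
        smul (Poly_Mapping.lookup h w) (word_eval b w)"
      by (simp add: word_eval_append scale_mult_left scale_mult_right)
  qed
  finally show ?thesis
    by (simp add: poly_eval_def sum_product)
qed

end

context algebra_completion
begin

lemma completion_closed_induct:
  assumes "closed {x. P x}" "\<And>a. P (emb a)"
  shows "P x"
proof -
  have "closure (range emb) \<subseteq> {x. P x}"
    using assms by (intro closure_minimal) auto
  then show ?thesis using dense_emb by auto
qed

lemma continuous_add' [continuous_intros]:
  "continuous_on S f \<Longrightarrow> continuous_on S g \<Longrightarrow> continuous_on S (\<lambda>x. f x + g x :: 'c)"
  using continuous_on_compose2[OF continuous_add, of S "\<lambda>x. (f x, g x)"]
  by (simp add: continuous_on_Pair)

lemma continuous_mult' [continuous_intros]: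
  "continuous_on S f \<Longrightarrow> continuous_on S g \<Longrightarrow> continuous_on S (\<lambda>x. f x * g x :: 'c)"
  using continuous_on_compose2[OF continuous_mult, of S "\<lambda>x. (f x, g x)"]
  by (simp add: continuous_on_Pair)

lemma continuous_scale' [continuous_intros]:
  "continuous_on S f \<Longrightarrow> continuous_on S (\<lambda>x. smulC k (f x))"
  using continuous_on_compose2[OF continuous_scale, of S f] by simp

lemma emb_zero: "emb 0 = 0"
  using emb_add[of 0 0] by simp

lemma assoc_algebra_completion: "assoc_algebra smulC"
proof
  fix k l and x y :: 'c
  show "smulC k (x + y) = smulC k x + smulC k y"
  proof (induction x rule: completion_closed_induct)
    case 1
    show ?case by (intro closed_Collect_eq continuous_intros)
  next
    case (2 a)
    show ?case
    proof (induction y rule: completion_closed_induct)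
      case 1
      show ?case by (intro closed_Collect_eq continuous_intros)
    next
      case (2 b)
      show ?case by (metis emb_add emb_scale scale_right_distrib)
    qed
  qed
  show "smulC (k + l) x = smulC k x + smulC l x"
  proof (induction x rule: completion_closed_induct)
    case 1
    show ?case by (intro closed_Collect_eq continuous_intros)
  next
    case (2 a)
    show ?case by (metis emb_add emb_scale scale_left_distrib)
  qed
  show "smulC k (smulC l x) = smulC (k * l) x"
  proof (induction x rule: completion_closed_induct)
    case 1
    show ?case by (intro closed_Collect_eq continuous_intros)
  next
    case (2 a)
    show ?case by (metis emb_scale scale_scale)
  qed
  show "smulC 1 x = x"
  proof (induction x rule: completion_closed_induct)
    case 1
    show ?case by (intro closed_Collect_eq continuous_intros)
  next
    case (2 a)
    show ?case by (metis emb_scale scale_one)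
  qed
  show "smulC k x * y = smulC k (x * y)"
  proof (induction x rule: completion_closed_induct)
    case 1
    show ?case by (intro closed_Collect_eq continuous_intros)
  next
    case (2 a)
    show ?case
    proof (induction y rule: completion_closed_induct)
      case 1
      show ?case by (intro closed_Collect_eq continuous_intros)
    next
      case (2 b)
      show ?case by (metis emb_mult emb_scale scale_mult_left)
    qed
  qed
  show "x * smulC k y = smulC k (x * y)"
  proof (induction x rule: completion_closed_induct)
    case 1
    show ?case by (intro closed_Collect_eq continuous_intros)
  next
    case (2 a)
    show ?case
    proof (induction y rule: completion_closed_induct)
      case 1
      show ?case by (intro closed_Collect_eq continuous_intros)
    next
      case (2 b)
      show ?case by (metis emb_mult emb_scale scale_mult_right)
    qed
  qed
qed

lemma metric_algebra_completion: "metric_algebra nrm smulC"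
proof -
  interpret C: assoc_algebra smulC by (rule assoc_algebra_completion)
  obtain \<gamma> where "\<gamma> > 0"
    and add: "\<And>a b c. dist (a + c) (b + c) \<le> \<gamma> * dist a (b::'a)"
    and scl: "\<And>k a b. dist (smul k a) (smul k b) \<le> \<gamma> * nrm k * dist a b"
    and mlt: "\<And>a b c. dist (a * c) (b * c) \<le> \<gamma> * dist c 0 * dist a (b::'a)"
    and mlt': "\<And>a b c. dist (c * a) (c * b) \<le> \<gamma> * dist c 0 * dist a (b::'a)"
    using metric_bounds by auto
  have ext: "P x y z"
    if "\<And>a b c. P (emb a) (emb b) (emb c)"
      and "\<And>y z. closed {x. P x y z}" "\<And>x z. closed {y. P x y z}" "\<And>x y. closed {z. P x y z}"
    for P and x y z :: 'c
    using that by (metis completion_closed_induct[of "\<lambda>x. P x y z"]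
        completion_closed_induct[of "\<lambda>y. P x y z" for x] completion_closed_induct[of "P x y" for x y])
  have "dist (x + z) (y + z) \<le> \<gamma> * dist x y" for x y z :: 'c
    by (rule ext[where P = "\<lambda>x y z. dist (x + z) (y + z) \<le> \<gamma> * dist x y"])
      (use add in \<open>auto simp: dist_emb simp flip: emb_add intro!: closed_Collect_le continuous_intros\<close>)
  moreover have "dist (smulC k x) (smulC k y) \<le> \<gamma> * nrm k * dist x y" for k and x y :: 'c
    by (rule ext[where P = "\<lambda>x y _. dist (smulC k x) (smulC k y) \<le> \<gamma> * nrm k * dist x y"])
      (use scl in \<open>auto simp: dist_emb simp flip: emb_scale intro!: closed_Collect_le continuous_intros\<close>)
  moreover have "dist (x * z) (y * z) \<le> \<gamma> * dist z 0 * dist x y" for x y z :: 'c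
    by (rule ext[where P = "\<lambda>x y z. dist (x * z) (y * z) \<le> \<gamma> * dist z 0 * dist x y"])
      (use mlt in \<open>auto simp: dist_emb simp flip: emb_mult emb_zero
         intro!: closed_Collect_le continuous_intros\<close>)
  moreover have "dist (z * x) (z * y) \<le> \<gamma> * dist z 0 * dist x y" for x y z :: 'c
    by (rule ext[where P = "\<lambda>x y z. dist (z * x) (z * y) \<le> \<gamma> * dist z 0 * dist x y"])
      (use mlt' in \<open>auto simp: dist_emb simp flip: emb_mult emb_zero
         intro!: closed_Collect_le continuous_intros\<close>)
  ultimately show ?thesis
    using \<open>\<gamma> > 0\<close> by unfold_locales blast
qed

end

end

theory Submission
  imports Defs
begin

text \<open>
  Evaluating a fixed polynomial uses only sums, products and scalar multiples, so it commutes
  with \<open>emb\<close> and is continuous on assignments for the topology of pointwise convergence.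
  The assignments with values in the range of \<open>emb\<close> are dense there, so a polynomial that
  vanishes on them vanishes everywhere.
\<close>

context algebra_completion
begin

lemma inj_emb: "inj emb"
  by (rule injI) (metis dist_emb dist_eq_0_iff)

lemma emb_sum: "emb (\<Sum>i\<in>I. f i) = (\<Sum>i\<in>I. emb (f i))"
  by (induction I rule: infinite_finite_induct) (simp_all add: emb_zero emb_add)

text \<open>The empty word causes no exception, because \<open>emb\<close> sends its dummy value 0
  to 0.\<close>

lemma emb_word_eval: "emb (word_eval a w) = word_eval (emb \<circ> a) w"
  by (induction a w rule: word_eval.induct) (simp_all add: emb_zero emb_mult)

lemma emb_poly_eval: "emb (poly_eval smul a g) = poly_eval smulC (emb \<circ> a) g"
  by (simp add: poly_eval_def emb_sum emb_scale emb_word_eval)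

text \<open>Continuity of addition on \<open>'c\<close> is a locale assumption, not a class
  instance, so finite sums get their own induction.\<close>

lemma continuous_sum:
  assumes "\<And>i. i \<in> I \<Longrightarrow> continuous_on S (f i)"
  shows "continuous_on S (\<lambda>x. \<Sum>i\<in>I. f i x :: 'c)"
  using assms by (induction I rule: infinite_finite_induct) (auto intro!: continuous_intros)

text \<open>Each letter is a coordinate projection of the product topology, and multiplication on
  \<open>'c\<close> is jointly continuous.\<close>

lemma continuous_word_eval: "continuous_on S (\<lambda>b :: nat \<Rightarrow> 'c. word_eval b w)"
proof (induction w)
  case (Cons i w)
  have "continuous_on S (\<lambda>b :: nat \<Rightarrow> 'c. b i)"
    by (rule continuous_on_subset[OF continuous_on_product_coordinates]) simp
  \<comment> \<open>A one-letter word is a case of its own: without a unit there is no factor for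
    the empty rest.\<close>
  with Cons show ?case
    by (cases w) (auto intro!: continuous_mult')
qed simp

lemma continuous_poly_eval: "continuous_on S (\<lambda>b. poly_eval smulC b g)"
  unfolding poly_eval_def
  by (intro continuous_sum continuous_scale' continuous_word_eval)

text \<open>The closure of a product of sets is the product of the closures, and every factor here
  is dense by \<open>dense_emb\<close>.\<close>

lemma dense_emb_assignments: "closure (range (\<lambda>a :: nat \<Rightarrow> 'a. emb \<circ> a)) = UNIV"
proof -
  have "range (\<lambda>a :: nat \<Rightarrow> 'a. emb \<circ> a) = (\<Pi>\<^sub>E i\<in>UNIV. range emb)"
  proof (intro equalityI subsetI)
    fix b :: "nat \<Rightarrow> 'c"
    assume "b \<in> (\<Pi>\<^sub>E i\<in>UNIV. range emb)"
    \<comment> \<open>Preimages are chosen separately in each coordinate.\<close>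
    then have "b = emb \<circ> (inv emb \<circ> b)"
      by (auto simp: fun_eq_iff f_inv_into_f PiE_iff)
    then show "b \<in> range (\<lambda>a. emb \<circ> a)" by blast
  qed auto
  then show ?thesis
    using closure_of_product_topology[of "\<lambda>_. euclidean" "UNIV :: nat set" "\<lambda>_. range emb"]
    by (simp add: dense_emb euclidean_product_topology)
qed

lemma poly_eval_completion_eq_0:
  assumes "\<And>a. poly_eval smul a g = 0"
  shows "poly_eval smulC b g = 0"
proof -
  have "closed {b. poly_eval smulC b g = 0}"
    by (intro closed_Collect_eq continuous_poly_eval continuous_on_const)
  moreover have "range (\<lambda>a. emb \<circ> a) \<subseteq> {b. poly_eval smulC b g = 0}"
    using assms by (auto simp: emb_zero simp flip: emb_poly_eval)
  ultimately have "closure (range (\<lambda>a. emb \<circ> a)) \<subseteq> {b. poly_eval smulC b g = 0}"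
    by (rule closure_minimal[rotated])
  then show ?thesis
    by (auto simp: dense_emb_assignments)
qed

lemma polynomial_identities_completion:
  "polynomial_identities smulC = polynomial_identities smul"
proof -
  \<comment> \<open>From left to right, take \<open>b = emb \<circ> a\<close> and cancel
    \<open>emb\<close> by injectivity; the converse is the density argument.\<close>
  have "(\<forall>b. poly_eval smulC b g = 0) \<longleftrightarrow> (\<forall>a. poly_eval smul a g = 0)" for g
    by (metis emb_poly_eval emb_zero inj_emb injD poly_eval_completion_eq_0)
  then show ?thesis
    by (simp add: polynomial_identities_def)
qed

end

theorem proposition2p5:
  fixes nrm :: "'f::field \<Rightarrow> real"
    and smul :: "'f \<Rightarrow> 'a::{ring, metric_space} \<Rightarrow> 'a"
    and smulC :: "'f \<Rightarrow> 'c::{ring, complete_space} \<Rightarrow> 'c"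
    and emb :: "'a \<Rightarrow> 'c"
  assumes "normed_field nrm"
    and "metric_algebra nrm smul"
    and "algebra_completion nrm smul smulC emb"
  shows "polynomial_identities smulC = polynomial_identities smul"
  using assms(3) by (rule algebra_completion.polynomial_identities_completion)

end
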